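(* Let $\Gamma$ be an elliptic graph with NN-elliptic sequence $\{B_j\}_{j=-1}^m$ and associated cycles $C_j=\sum_{i=-1}^j Z_{B_i}$ ($-1\le j\le m$). Let $\ell\in Supp(P_0)$ be an exponent of the canonical polynomial of $\Gamma$ and let $l'$ be its associated cycle. Then (1) $l'\in\{C_{-1},C_0,\dots,C_{m-1}\}$; (2) for every $j$ and every $\ell\in Supp_j(P_0)$ one has $\mathcal V^{<0}(\ell)=\mathcal V(\Gamma)\setminus \mathcal V(B_{j+1})$.
   Context: Let $\Gamma$ be a finite connected tree with vertex set $\mathcal V$, each vertex $v$ decorated by an integer $e_v$ (all genus decorations zero). Let $L$ be the free abelian group with basis $\{E_v\}_{v\in\mathcal V}$ and symmetric bilinear form $(E_v,E_v)=e_v$, $(E_v,E_w)=1$ if $v\neq w$ are adjacent and $0$ otherwise; it is assumed negative definite. Let $L'=\{l'\in L\otimes\mathbb Q:(l',l)\in\mathbb Z\ \forall l\in L\}$, $H=L'/L$, and $[l']$ the class of $l'$. Let $E_v^*\in L'$ be defined by $(E_v^*,E_w)=-\delta_{vw}$. For $l'=\sum_v l'_vE_v$ write $l'_1\ge l'_2$ if $l'_{1,v}\ge l'_{2,v}$ for all $v$, $l'_1\prec l'_2$ if $l'_{1,v}<l'_{2,v}$ for all $v$, $l>0$ if $l\ge0,l\ne0$; $|l'|=\{v:l'_v\ne0\}$; $E=\sum_vE_v$; $\delta_v$ is the valency of $v$. The anticanonical cycle $Z_K\in L'$ is defined by $(Z_K,E_v)=e_v+2$ for all $v$, and $\chi(l')=-(l',l'-Z_K)/2$.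 Let $\mathcal S'=\{l'\in L':(l',E_v)\le0\ \forall v\}$, $\mathcal S'_h=\{l'\in\mathcal S':[l']=h\}$, and $s_h=\min\mathcal S'_h$ (coordinatewise minimum; it lies in $\mathcal S'_h$). For a connected full subgraph $B$ the same notions are defined using only the vertices of $B$; $Z_{min}(B)$ denotes the minimal nonzero element of $\mathcal S'(B)\cap L(B)$. Topological Poincaré series: $Z(\mathbf t)=\sum_{l'\in L'}z(l')\mathbf t^{l'}$ is the Taylor expansion at the origin of $\prod_{v}(1-\mathbf t^{E_v^*})^{\delta_v-2}$, where $\mathbf t^{l'}=\prod_v t_v^{l'_v}$. Canonical polynomial: $P_0(\mathbf t)=\sum_{\ell\in L,\ \ell\not\prec 0}w(\ell)\mathbf t^{\ell}$ with $w(\ell)=z(Z_K-E-\ell)$, and $Supp(P_0)=\{\ell\in L:\ell\not\prec0,\ w(\ell)\ne0\}$. An elliptic graph is such a $\Gamma$ with $e_v\le-2$ for all $v$ and $\min_{l\in L,l>0}\chi(l)=0$. The minimally elliptic cycle $C$ is the unique $C\in L$, $C>0$, with $\chi(C)=0$ and $\chi(l)>0$ for $0<l<C$. NN-elliptic sequence: $B_{-1}=\Gamma$, $Z_{B_{-1}}=s_{[Z_K]}$, $B_0=|Z_K-s_{[Z_K]}|$; for $j\ge0$, $Z_{B_j}=Z_{min}(B_j)$ (viewed in $L$), and if $Z_K-\sum_{i=-1}^jZ_{B_i}\neq0$ one sets $B_{j+1}=|Z_K-\sum_{i=-1}^jZ_{B_i}|$; $m$ is the index with $Z_K=\sum_{i=-1}^mZ_{B_i}$.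 (It is known that this is well defined, each $B_j$, $j\ge0$, is a connected elliptic full subgraph, and $B_m=|C|$.) Set $C_j=\sum_{i=-1}^jZ_{B_i}$. For $\ell\in Supp(P_0)$ let $\mathcal V^{<0}(\ell)=\{v:\ell_v<0\}$; its associated cycle is the unique $l'\in L'$ with $\ell=Z_K-E-l'-\sum_{v\in\mathcal V^{<0}(\ell)}m_vE_v$, where $l'\le Z_K$, $l'_v=(Z_K)_v$ for $v\in\mathcal V^{<0}(\ell)$, and $m_v\in\mathbb Z_{\ge0}$. $Supp_j(P_0)$ denotes the set of $\ell\in Supp(P_0)$ whose associated cycle is $C_j$. *)

theory Defs
  imports Complex_Main
begin

text \<open>Plumbed graph data: a finite vertex set V, an adjacency relation adj and
integer decorations e. Elements of L and of L tensor Q are represented as functions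
'v => rat vanishing outside V.\<close>

definition supported :: "'v set \<Rightarrow> ('v \<Rightarrow> rat) \<Rightarrow> bool" where
  "supported S x \<longleftrightarrow> (\<forall>v. v \<notin> S \<longrightarrow> x v = 0)"

definition integral :: "('v \<Rightarrow> rat) \<Rightarrow> bool" where
  "integral x \<longleftrightarrow> (\<forall>v. x v \<in> \<int>)"

definition lleq :: "'v set \<Rightarrow> ('v \<Rightarrow> rat) \<Rightarrow> ('v \<Rightarrow> rat) \<Rightarrow> bool" where
  "lleq V x y \<longleftrightarrow> (\<forall>v\<in>V. x v \<le> y v)"

definition edges :: "'v set \<Rightarrow> ('v \<Rightarrow> 'v \<Rightarrow> bool) \<Rightarrow> 'v set set" where
  "edges V adj = {{v, w} | v w. v \<in> V \<and> w \<in> V \<and> adj v w}"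

definition is_tree :: "'v set \<Rightarrow> ('v \<Rightarrow> 'v \<Rightarrow> bool) \<Rightarrow> bool" where
  "is_tree V adj \<longleftrightarrow> finite V \<and> V \<noteq> {} \<and>
     (\<forall>v w. adj v w \<longrightarrow> v \<in> V \<and> w \<in> V) \<and>
     (\<forall>v w. adj v w \<longrightarrow> adj w v) \<and> (\<forall>v. \<not> adj v v) \<and>
     (\<forall>v\<in>V. \<forall>w\<in>V. (v, w) \<in> {(a, b). adj a b}\<^sup>*) \<and>
     card (edges V adj) + 1 = card V"

definition valency :: "'v set \<Rightarrow> ('v \<Rightarrow> 'v \<Rightarrow> bool) \<Rightarrow> 'v \<Rightarrow> nat" where
  "valency V adj v = card {w \<in> V. adj v w}"

definition intmat :: "('v \<Rightarrow> 'v \<Rightarrow> bool) \<Rightarrow> ('v \<Rightarrow> int) \<Rightarrow> 'v \<Rightarrow> 'v \<Rightarrow> rat" where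
  "intmat adj e v w = (if v = w then of_int (e v) else if adj v w then 1 else 0)"

definition form :: "'v set \<Rightarrow> ('v \<Rightarrow> 'v \<Rightarrow> bool) \<Rightarrow> ('v \<Rightarrow> int) \<Rightarrow> ('v \<Rightarrow> rat) \<Rightarrow> ('v \<Rightarrow> rat) \<Rightarrow> rat" where
  "form V adj e x y = (\<Sum>v\<in>V. \<Sum>w\<in>V. intmat adj e v w * x v * y w)"

definition Ebas :: "'v \<Rightarrow> 'v \<Rightarrow> rat" where
  "Ebas v = (\<lambda>w. if w = v then 1 else 0)"

definition Etot :: "'v set \<Rightarrow> 'v \<Rightarrow> rat" where
  "Etot V = (\<lambda>w. if w \<in> V then 1 else 0)"

definition Lat :: "'v set \<Rightarrow> ('v \<Rightarrow> rat) set" where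
  "Lat V = {x. supported V x \<and> integral x}"

definition Ldual :: "'v set \<Rightarrow> ('v \<Rightarrow> 'v \<Rightarrow> bool) \<Rightarrow> ('v \<Rightarrow> int) \<Rightarrow> ('v \<Rightarrow> rat) set" where
  "Ldual V adj e = {x. supported V x \<and> (\<forall>l\<in>Lat V. form V adj e x l \<in> \<int>)}"

definition negdef :: "'v set \<Rightarrow> ('v \<Rightarrow> 'v \<Rightarrow> bool) \<Rightarrow> ('v \<Rightarrow> int) \<Rightarrow> bool" where
  "negdef V adj e \<longleftrightarrow> (\<forall>l\<in>Lat V. l \<noteq> (\<lambda>_. 0) \<longrightarrow> form V adj e l l < 0)"

text \<open>Dual basis element E_v^*: (E_v^*, E_w) = - delta_vw.\<close>
definition Estar :: "'v set \<Rightarrow> ('v \<Rightarrow> 'v \<Rightarrow> bool) \<Rightarrow> ('v \<Rightarrow> int) \<Rightarrow> 'v \<Rightarrow> 'v \<Rightarrow> rat" where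
  "Estar V adj e v = (THE x. supported V x \<and>
      (\<forall>w\<in>V. form V adj e x (Ebas w) = (if v = w then -1 else 0)))"

text \<open>Anticanonical cycle: (Z_K, E_v) = e_v + 2.\<close>
definition ZK :: "'v set \<Rightarrow> ('v \<Rightarrow> 'v \<Rightarrow> bool) \<Rightarrow> ('v \<Rightarrow> int) \<Rightarrow> 'v \<Rightarrow> rat" where
  "ZK V adj e = (THE x. supported V x \<and>
      (\<forall>v\<in>V. form V adj e x (Ebas v) = of_int (e v) + 2))"

definition chi :: "'v set \<Rightarrow> ('v \<Rightarrow> 'v \<Rightarrow> bool) \<Rightarrow> ('v \<Rightarrow> int) \<Rightarrow> ('v \<Rightarrow> rat) \<Rightarrow> rat" where
  "chi V adj e l = - form V adj e l (\<lambda>w. l w - ZK V adj e w) / 2"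

definition elliptic_graph :: "'v set \<Rightarrow> ('v \<Rightarrow> 'v \<Rightarrow> bool) \<Rightarrow> ('v \<Rightarrow> int) \<Rightarrow> bool" where
  "elliptic_graph V adj e \<longleftrightarrow> is_tree V adj \<and> negdef V adj e \<and> (\<forall>v\<in>V. e v \<le> -2) \<and>
     (\<forall>l\<in>Lat V. lleq V (\<lambda>_. 0) l \<and> l \<noteq> (\<lambda>_. 0) \<longrightarrow> chi V adj e l \<ge> 0) \<and>
     (\<exists>l\<in>Lat V. lleq V (\<lambda>_. 0) l \<and> l \<noteq> (\<lambda>_. 0) \<and> chi V adj e l = 0)"

text \<open>Coefficient of x^k in the Taylor expansion of (1 - x)^n at 0, n an integer.\<close>
definition binom_coef :: "int \<Rightarrow> nat \<Rightarrow> rat" where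
  "binom_coef n k = (-1) ^ k * ((of_int n :: rat) gchoose k)"

text \<open>Coefficient z(l') of t^l' in the Taylor expansion at the origin of
  prod_v (1 - t^(E_v^*))^(delta_v - 2): the sum over all exponent vectors (k_v)
  with sum_v k_v E_v^* = l' of prod_v coeff_{k_v}((1-x)^(delta_v-2)).\<close>
definition zcoef :: "'v set \<Rightarrow> ('v \<Rightarrow> 'v \<Rightarrow> bool) \<Rightarrow> ('v \<Rightarrow> int) \<Rightarrow> ('v \<Rightarrow> rat) \<Rightarrow> rat" where
  "zcoef V adj e l' =
     (\<Sum>k \<in> {k :: 'v \<Rightarrow> nat. (\<forall>v. v \<notin> V \<longrightarrow> k v = 0) \<and>
                (\<forall>w. (\<Sum>v\<in>V. of_nat (k v) * Estar V adj e v w) = l' w)}.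
        \<Prod>v\<in>V. binom_coef (int (valency V adj v) - 2) (k v))"

text \<open>Supp(P_0) = {ell in L : not (ell < 0 coordinatewise strictly), w(ell) ~= 0},
  with w(ell) = z(Z_K - E - ell).\<close>
definition SuppP0 :: "'v set \<Rightarrow> ('v \<Rightarrow> 'v \<Rightarrow> bool) \<Rightarrow> ('v \<Rightarrow> int) \<Rightarrow> ('v \<Rightarrow> rat) set" where
  "SuppP0 V adj e = {l \<in> Lat V. \<not> (\<forall>v\<in>V. l v < 0) \<and>
       zcoef V adj e (\<lambda>w. ZK V adj e w - Etot V w - l w) \<noteq> 0}"

definition Vneg :: "'v set \<Rightarrow> ('v \<Rightarrow> rat) \<Rightarrow> 'v set" where
  "Vneg V l = {v\<in>V. l v < 0}"

definition supp :: "'v set \<Rightarrow> ('v \<Rightarrow> rat) \<Rightarrow> 'v set" where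
  "supp V x = {v\<in>V. x v \<noteq> 0}"

text \<open>l' is the associated cycle of ell.\<close>
definition is_assoc :: "'v set \<Rightarrow> ('v \<Rightarrow> 'v \<Rightarrow> bool) \<Rightarrow> ('v \<Rightarrow> int) \<Rightarrow> ('v \<Rightarrow> rat) \<Rightarrow> ('v \<Rightarrow> rat) \<Rightarrow> bool" where
  "is_assoc V adj e l lp \<longleftrightarrow> lp \<in> Ldual V adj e \<and> lleq V lp (ZK V adj e) \<and>
     (\<forall>v\<in>Vneg V l. lp v = ZK V adj e v) \<and>
     (\<exists>m. (\<forall>v. m v \<in> \<int> \<and> m v \<ge> 0) \<and>
        (\<forall>v\<in>V. l v = ZK V adj e v - 1 - lp v - (if v \<in> Vneg V l then m v else 0)))"

text \<open>S'_{[Z_K]} and its minimum s_{[Z_K]}.\<close>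
definition SpK :: "'v set \<Rightarrow> ('v \<Rightarrow> 'v \<Rightarrow> bool) \<Rightarrow> ('v \<Rightarrow> int) \<Rightarrow> ('v \<Rightarrow> rat) set" where
  "SpK V adj e = {x \<in> Ldual V adj e. (\<forall>v\<in>V. form V adj e x (Ebas v) \<le> 0) \<and>
       integral (\<lambda>w. x w - ZK V adj e w)}"

definition sK :: "'v set \<Rightarrow> ('v \<Rightarrow> 'v \<Rightarrow> bool) \<Rightarrow> ('v \<Rightarrow> int) \<Rightarrow> 'v \<Rightarrow> rat" where
  "sK V adj e = (THE x. x \<in> SpK V adj e \<and> (\<forall>y\<in>SpK V adj e. lleq V x y))"

text \<open>Z_min(B): minimal nonzero element of S'(B) intersected with L(B).\<close>
definition ZminSet :: "'v set \<Rightarrow> ('v \<Rightarrow> 'v \<Rightarrow> bool) \<Rightarrow> ('v \<Rightarrow> int) \<Rightarrow> 'v set \<Rightarrow> ('v \<Rightarrow> rat) set" where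
  "ZminSet V adj e B = {x. supported B x \<and> integral x \<and> x \<noteq> (\<lambda>_. 0) \<and>
       (\<forall>v\<in>B. form V adj e x (Ebas v) \<le> 0)}"

definition Zmin :: "'v set \<Rightarrow> ('v \<Rightarrow> 'v \<Rightarrow> bool) \<Rightarrow> ('v \<Rightarrow> int) \<Rightarrow> 'v set \<Rightarrow> 'v \<Rightarrow> rat" where
  "Zmin V adj e B = (THE x. x \<in> ZminSet V adj e B \<and> (\<forall>y\<in>ZminSet V adj e B. lleq B x y))"

text \<open>NN-elliptic sequence, shifted by one: NN_C k = C_{k-1}, NN_B k = B_{k-1}.\<close>
primrec NN_C :: "'v set \<Rightarrow> ('v \<Rightarrow> 'v \<Rightarrow> bool) \<Rightarrow> ('v \<Rightarrow> int) \<Rightarrow> nat \<Rightarrow> 'v \<Rightarrow> rat" where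
  "NN_C V adj e 0 = sK V adj e"
| "NN_C V adj e (Suc k) = (\<lambda>w. NN_C V adj e k w +
     Zmin V adj e (supp V (\<lambda>u. ZK V adj e u - NN_C V adj e k u)) w)"

primrec NN_B :: "'v set \<Rightarrow> ('v \<Rightarrow> 'v \<Rightarrow> bool) \<Rightarrow> ('v \<Rightarrow> int) \<Rightarrow> nat \<Rightarrow> 'v set" where
  "NN_B V adj e 0 = V"
| "NN_B V adj e (Suc k) = supp V (\<lambda>u. ZK V adj e u - NN_C V adj e k u)"

end

theory Submission
  imports Defs
begin

text \<open>Write \<open>x = Z\<^sub>K - E - \<ell>\<close>. If \<open>z(x) \<noteq> 0\<close> then \<open>x\<close> is a nonnegative combination of the \<open>E\<^sub>v\<^sup>*\<close>,
so \<open>x\<close> lies in \<open>S'\<close>, and the associated cycle is the coordinatewise minimum \<open>l'\<close> of \<open>x\<close> and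
\<open>Z\<^sub>K\<close>, again in \<open>S'\<close>. For any \<open>c \<in> S'\<close> with \<open>c \<le> Z\<^sub>K\<close> in the class of \<open>Z\<^sub>K\<close>, put
\<open>D = Z\<^sub>K - c\<close>; then \<open>0 \<le> \<chi>(D) = (D, c)/2 \<le> 0\<close>, so \<open>c\<close> is orthogonal to every \<open>E\<^sub>v\<close> with \<open>v\<close>
in the support of \<open>D\<close>. Moreover this support is connected: if two nonzero effective cycles with
\<open>\<chi> = 0\<close> had disjoint supports, one could enlarge one of them by adjacent vertices, keeping
\<open>\<chi> = 0\<close>, until it touches the other, and their sum would have \<open>\<chi> < 0\<close>.
Now if \<open>C\<^sub>j \<le> l'\<close> and \<open>C\<^sub>j \<noteq> l'\<close>, orthogonality of \<open>C\<^sub>j\<close> shows that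
\<open>l' - C\<^sub>j\<close> is a nonzero anti-nef cycle on \<open>B\<^bsub>j+1\<^esub>\<close>, hence \<open>l' \<ge> C\<^bsub>j+1\<^esub>\<close>. The sequence reaches
\<open>Z\<^sub>K\<close>, while \<open>l' \<noteq> Z\<^sub>K\<close> because \<open>\<ell>\<close> has a nonnegative coordinate.\<close>

section \<open>The intersection form\<close>

lemma form_linear_left:
  "form V adj e (\<lambda>v. a * x v + b * y v) z = a * form V adj e x z + b * form V adj e y z"
  by (simp add: form_def sum_distrib_left sum.distrib algebra_simps)

lemma form_add_left:
  "form V adj e (\<lambda>v. x v + y v) z = form V adj e x z + form V adj e y z"
  using form_linear_left[of V adj e 1 x 1 y z] by simp

lemma form_diff_left:
  "form V adj e (\<lambda>v. x v - y v) z = form V adj e x z - form V adj e y z"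
  using form_linear_left[of V adj e 1 x "-1" y z] by simp

lemma form_sum_left:
  "form V adj e (\<lambda>v. \<Sum>i\<in>I. c i * x i v) z = (\<Sum>i\<in>I. c i * form V adj e (x i) z)"
proof (induction I rule: infinite_finite_induct)
  case (insert i I)
  then show ?case
    using form_linear_left[of V adj e "c i" "x i" 1 "\<lambda>v. \<Sum>i\<in>I. c i * x i v" z] by simp
qed (simp_all add: form_def)

lemma form_cong:
  assumes "\<And>v. v \<in> V \<Longrightarrow> x v = x' v" "\<And>v. v \<in> V \<Longrightarrow> y v = y' v"
  shows "form V adj e x y = form V adj e x' y'"
  unfolding form_def using assms by (intro sum.cong) auto

section \<open>Auxiliary facts on rational vectors\<close>

text \<open>An element minimizing the sum \<open>h\<close> of the floors over \<open>A\<close> is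
  least. If some \<open>y\<close> were smaller at one coordinate, the difference there would be a
  positive integer, so the minimum with \<open>y\<close> would have a strictly smaller floor at that
  coordinate and no larger floor elsewhere.\<close>

lemma exists_coordinatewise_minimum:
  fixes S :: "('v \<Rightarrow> rat) set"
  assumes "finite A" and "S \<noteq> {}"
    and nonneg: "\<And>x v. \<lbrakk>x \<in> S; v \<in> A\<rbrakk> \<Longrightarrow> 0 \<le> x v"
    and same_class: "\<And>x y v. \<lbrakk>x \<in> S; y \<in> S; v \<in> A\<rbrakk> \<Longrightarrow> x v - y v \<in> \<int>"
    and min_closed: "\<And>x y. \<lbrakk>x \<in> S; y \<in> S\<rbrakk> \<Longrightarrow> (\<lambda>v. min (x v) (y v)) \<in> S"
  shows "\<exists>x\<in>S. \<forall>y\<in>S. lleq A x y"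
proof -
  define h where "h = (\<lambda>x :: 'v \<Rightarrow> rat. \<Sum>v\<in>A. nat \<lfloor>x v\<rfloor>)"
  obtain x where x: "x \<in> S" and least: "\<And>y. y \<in> S \<Longrightarrow> h x \<le> h y"
    using ex_has_least_nat[of "\<lambda>x. x \<in> S" _ h] \<open>S \<noteq> {}\<close> by blast
  have "x v \<le> y v" if y: "y \<in> S" and v: "v \<in> A" for y v
  proof (rule ccontr)
    assume "\<not> x v \<le> y v"
    then have lt: "y v < x v" by simp
    obtain i where i: "x v - y v = of_int i"
      using same_class[OF x y v] by (auto elim: Ints_cases)
    with lt have "i \<ge> 1" by (metis diff_gt_0_iff_gt of_int_0_less_iff zero_less_imp_eq_int
        int_one_le_iff_zero_less)
    moreover have "\<lfloor>x v\<rfloor> = \<lfloor>y v\<rfloor> + i"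
      using i by (metis add.commute diff_add_cancel floor_add_int)
    moreover have "0 \<le> \<lfloor>y v\<rfloor>" using nonneg[OF y v] by simp
    ultimately have "nat \<lfloor>y v\<rfloor> < nat \<lfloor>x v\<rfloor>" by linarith
    then have strict: "nat \<lfloor>min (x v) (y v)\<rfloor> < nat \<lfloor>x v\<rfloor>"
      using lt by (simp add: min_def)
    have "h (\<lambda>v. min (x v) (y v)) < h x"
      unfolding h_def
    proof (rule sum_strict_mono_ex1[OF \<open>finite A\<close>])
      show "\<forall>v\<in>A. nat \<lfloor>min (x v) (y v)\<rfloor> \<le> nat \<lfloor>x v\<rfloor>"
        by (intro ballI nat_mono floor_mono) simp
    qed (use v strict in blast)
    then show False using least[OF min_closed[OF x y]] by simp
  qed
  then show ?thesis using x unfolding lleq_def by blast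
qed

text \<open>\<open>negdef\<close> speaks of integral vectors only; clearing denominators extends
  negative definiteness to rational ones in \<open>form_neg\<close>.\<close>

lemma ex_common_denominator:
  fixes x :: "'v \<Rightarrow> rat"
  assumes "finite A"
  shows "\<exists>n::int. n > 0 \<and> (\<forall>v\<in>A. of_int n * x v \<in> \<int>)"
  using assms
proof (induction A rule: finite_induct)
  case empty
  show ?case by (intro exI[of _ 1]) simp
next
  case (insert u A)
  then obtain n :: int where n: "n > 0" "\<forall>v\<in>A. of_int n * x v \<in> \<int>" by blast
  obtain a b where ab: "b > 0" "x u = of_int a / of_int b"
    by (metis quotient_of_denom_pos quotient_of_div surj_pair)
  have "of_int (n * b) * x u = of_int (n * a)" using ab by simp
  then have "of_int (n * b) * x u \<in> \<int>" by (metis Ints_of_int)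
  moreover have "of_int (n * b) * x v \<in> \<int>" if "v \<in> A" for v
  proof -
    have "of_int (n * b) * x v = of_int b * (of_int n * x v)" by simp
    then show ?thesis using n(2) that by (metis Ints_mult Ints_of_int)
  qed
  ultimately show ?case using n(1) ab(1) by (intro exI[of _ "n * b"]) simp
qed

locale negdef_graph =
  fixes V :: "'v set" and adj :: "'v \<Rightarrow> 'v \<Rightarrow> bool" and e :: "'v \<Rightarrow> int"
  assumes finite_V: "finite V"
    and adj_sym: "adj v w \<Longrightarrow> adj w v"
    and negdef: "negdef V adj e"
begin

abbreviation "frm \<equiv> form V adj e"
abbreviation "pair x v \<equiv> form V adj e x (Ebas v)"
abbreviation "K \<equiv> ZK V adj e"
abbreviation "\<chi> \<equiv> chi V adj e"

lemma form_sym: "frm x y = frm y x"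
proof -
  have "intmat adj e v w = intmat adj e w v" for v w
    using adj_sym by (auto simp: intmat_def)
  then show ?thesis
    unfolding form_def by (subst sum.swap) (simp add: mult.assoc mult.left_commute mult.commute)
qed

lemma pair_eq: "v \<in> V \<Longrightarrow> pair x v = (\<Sum>u\<in>V. intmat adj e u v * x u)"
proof -
  assume v: "v \<in> V"
  have "(\<Sum>w\<in>V. intmat adj e u w * x u * Ebas v w) = intmat adj e u v * x u" for u
    using finite_V v by (simp add: Ebas_def if_distrib cong: if_cong)
  then show ?thesis unfolding form_def by simp
qed

lemma form_eq_sum_pair: "frm x y = (\<Sum>v\<in>V. y v * pair x v)"
proof -
  have "frm x y = (\<Sum>w\<in>V. \<Sum>u\<in>V. intmat adj e u w * x u * y w)"
    unfolding form_def by (rule sum.swap)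
  also have "\<dots> = (\<Sum>w\<in>V. y w * pair x w)"
    by (intro sum.cong refl) (simp add: pair_eq sum_distrib_left mult.commute)
  finally show ?thesis .
qed

text \<open>Only the diagonal entry of the intersection matrix can be negative, and it multiplies a
  coordinate on which \<open>x\<close> and \<open>y\<close> agree.\<close>

lemma pair_mono:
  assumes "v \<in> V" "x v = y v" "\<And>u. u \<in> V \<Longrightarrow> x u \<le> y u"
  shows "pair x v \<le> pair y v"
  unfolding pair_eq[OF assms(1)]
proof (rule sum_mono)
  fix u assume "u \<in> V"
  then show "intmat adj e u v * x u \<le> intmat adj e u v * y u"
    using assms by (cases "u = v") (auto simp: intmat_def)
qed

lemma pair_zero [simp]: "pair (\<lambda>_. 0) v = 0"
  by (simp add: form_def)

lemma pair_nonneg: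
  assumes "v \<in> V" "x v = 0" "\<And>u. u \<in> V \<Longrightarrow> 0 \<le> x u"
  shows "0 \<le> pair x v"
  using pair_mono[of v "\<lambda>_. 0" x] assms by simp

lemma pair_pos:
  assumes "v \<in> V" "x v = 0" "\<And>u. u \<in> V \<Longrightarrow> 0 \<le> x u" "w \<in> V" "adj w v" "x w > 0"
  shows "x w \<le> pair x v"
proof -
  have "w \<noteq> v" using assms by auto
  then have "x w = intmat adj e w v * x w" using assms by (simp add: intmat_def)
  also have "\<dots> \<le> (\<Sum>u\<in>V. intmat adj e u v * x u)"
    using assms finite_V
    by (intro member_le_sum) (auto simp: intmat_def)
  finally show ?thesis using assms(1) by (simp add: pair_eq)
qed

lemma pair_Ebas_self: "v \<in> V \<Longrightarrow> pair (Ebas v) v = of_int (e v)"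
proof -
  assume v: "v \<in> V"
  have "(\<Sum>u\<in>V. intmat adj e u v * Ebas v u) = intmat adj e v v"
    using finite_V v by (simp add: Ebas_def if_distrib cong: if_cong)
  then show ?thesis using v by (simp add: pair_eq intmat_def)
qed

lemma pair_integral: "\<lbrakk>v \<in> V; integral x\<rbrakk> \<Longrightarrow> pair x v \<in> \<int>"
  unfolding pair_eq by (intro Ints_sum Ints_mult) (auto simp: intmat_def integral_def)

lemma in_Ldual_iff: "x \<in> Ldual V adj e \<longleftrightarrow> supported V x \<and> (\<forall>v\<in>V. pair x v \<in> \<int>)"
proof
  assume "x \<in> Ldual V adj e"
  moreover have "Ebas v \<in> Lat V" if "v \<in> V" for v
    using that by (auto simp: Lat_def supported_def integral_def Ebas_def)
  ultimately show "supported V x \<and> (\<forall>v\<in>V. pair x v \<in> \<int>)"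
    unfolding Ldual_def by blast
next
  assume x: "supported V x \<and> (\<forall>v\<in>V. pair x v \<in> \<int>)"
  have "frm x l \<in> \<int>" if "l \<in> Lat V" for l
    using x that unfolding form_eq_sum_pair[of x l] Lat_def integral_def
    by (auto intro!: Ints_sum Ints_mult)
  then show "x \<in> Ldual V adj e" using x by (simp add: Ldual_def)
qed

lemma form_neg:
  assumes "supported V x" "x \<noteq> (\<lambda>_. 0)"
  shows "frm x x < 0"
proof -
  obtain n :: int where n: "n > 0" "\<forall>v\<in>V. of_int n * x v \<in> \<int>"
    using ex_common_denominator[OF finite_V] by blast
  define y where "y = (\<lambda>v. of_int n * x v)"
  have "y v \<in> \<int>" for v
    using n(2) assms(1) by (cases "v \<in> V") (simp_all add: y_def supported_def)
  then have "y \<in> Lat V" using assms(1) by (simp add: Lat_def supported_def integral_def y_def)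
  moreover have "y \<noteq> (\<lambda>_. 0)" using assms(2) n(1) by (auto simp: y_def fun_eq_iff)
  ultimately have "frm y y < 0" using negdef by (auto simp: negdef_def)
  moreover have "frm y y = of_int (n * n) * frm x x"
    unfolding form_def y_def by (simp add: sum_distrib_left algebra_simps)
  ultimately show ?thesis using n(1) by (simp add: mult_less_0_iff zero_less_mult_iff)
qed

section \<open>Cycles with prescribed intersection numbers\<close>

lemma pair_unique:
  assumes "supported V x" "supported V y" "\<And>v. v \<in> V \<Longrightarrow> pair x v = pair y v"
  shows "x = y"
proof (rule ccontr)
  define d where "d = (\<lambda>v. x v - y v)"
  assume "x \<noteq> y"
  then have "d \<noteq> (\<lambda>_. 0)" by (auto simp: d_def fun_eq_iff)
  moreover have "supported V d" using assms by (simp add: supported_def d_def)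
  ultimately have "frm d d < 0" by (rule form_neg[rotated])
  moreover have "frm d d = 0"
    unfolding form_eq_sum_pair[of d d] using assms(3) by (simp add: d_def form_diff_left)
  ultimately show False by simp
qed

text \<open>Induction on the set of vertices: with \<open>z\<close> solving the system whose right hand side is the
row of a new vertex \<open>u\<close>, the vector \<open>p = E\<^sub>u - z\<close> is orthogonal to the old vertices, so
\<open>(p, E\<^sub>u) = (p, p)\<close> is invertible.\<close>

lemma ex_pair_eq:
  assumes "A \<subseteq> V"
  shows "\<exists>x. supported A x \<and> (\<forall>v\<in>A. pair x v = b v)"
proof -
  have "finite A" using assms finite_V finite_subset by blast
  then show ?thesis using assms
  proof (induction A arbitrary: b rule: finite_induct)
    case empty
    show ?case by (intro exI[of _ "\<lambda>_. 0"]) (simp add: supported_def)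
  next
    case (insert u A)
    then have A: "A \<subseteq> V" and u: "u \<in> V" by auto
    obtain y where y: "supported A y" "\<forall>v\<in>A. pair y v = b v" using insert.IH A by blast
    obtain z where z: "supported A z" "\<forall>v\<in>A. pair z v = pair (Ebas u) v"
      using insert.IH[OF A, of "\<lambda>v. pair (Ebas u) v"] by blast
    define p where "p = (\<lambda>v. Ebas u v - z v)"
    have pA: "pair p v = 0" if "v \<in> A" for v
      using z(2) that by (simp add: p_def form_diff_left)
    have pu: "p u = 1" using z(1) insert.hyps by (simp add: p_def Ebas_def supported_def)
    have supp_p: "supported (insert u A) p"
      using z(1) by (auto simp: p_def Ebas_def supported_def)
    then have "supported V p" using A u by (auto simp: supported_def)
    moreover have "p \<noteq> (\<lambda>_. 0)" using pu by (metis zero_neq_one)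
    ultimately have "frm p p < 0" by (rule form_neg)
    moreover have "frm p p = (\<Sum>v\<in>{u}. p v * pair p v)"
      unfolding form_eq_sum_pair[of p p]
    proof (rule sum.mono_neutral_right[OF finite_V])
      show "\<forall>v\<in>V - {u}. p v * pair p v = 0"
        using supp_p pA by (auto simp: supported_def)
    qed (use u in auto)
    ultimately have nz: "pair p u \<noteq> 0" using pu by auto
    define t where "t = (b u - pair y u) / pair p u"
    define x where "x = (\<lambda>v. 1 * y v + t * p v)"
    have "pair x v = pair y v + t * pair p v" for v
      unfolding x_def form_linear_left by simp
    then have "\<forall>v\<in>insert u A. pair x v = b v"
      using y(2) pA nz by (auto simp: t_def)
    moreover have "supported (insert u A) x"
      using y(1) supp_p by (auto simp: x_def supported_def)
    ultimately show ?case by blast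
  qed
qed

text \<open>Justifies the definite descriptions behind \<open>ZK\<close> and
  \<open>Estar\<close>.\<close>

lemma ex1_pair_eq: "\<exists>!x. supported V x \<and> (\<forall>v\<in>V. pair x v = b v)"
  using ex_pair_eq[of V b] pair_unique by (metis subset_refl)

lemma ZK_supported: "supported V K"
  and pair_ZK: "v \<in> V \<Longrightarrow> pair K v = of_int (e v) + 2"
  using theI'[OF ex1_pair_eq[of "\<lambda>v. of_int (e v) + 2"]] unfolding ZK_def by blast+

lemma pair_Estar: "w \<in> V \<Longrightarrow> pair (Estar V adj e v) w = (if v = w then -1 else 0)"
  using theI'[OF ex1_pair_eq[of "\<lambda>w. if v = w then -1 else 0"]] unfolding Estar_def by blast+

text \<open>Split x = p - n into positive and negative parts. Then (x,n) is at most 0 because n is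
  effective and lives on \<open>A\<close>, while (p,n) is at least 0 because p and n have disjoint
  supports. Hence (n,n) = (p,n) - (x,n) is nonnegative, and negative definiteness forces n =
  0.\<close>

lemma antinef_nonneg:
  assumes "A \<subseteq> V" "supported A x" "\<And>v. v \<in> A \<Longrightarrow> pair x v \<le> 0"
  shows "0 \<le> x v"
proof -
  define n where "n = (\<lambda>v. max 0 (- x v))"
  define p where "p = (\<lambda>v. max 0 (x v))"
  have n: "n v = p v - x v" for v by (simp add: n_def p_def max_def)
  have "frm x n \<le> 0"
    unfolding form_eq_sum_pair[of x n]
  proof (rule sum_nonpos)
    fix w
    show "n w * pair x w \<le> 0"
    proof (cases "w \<in> A")
      case True
      then show ?thesis using assms(3) by (simp add: n_def mult_le_0_iff)
    next
      case False
      then show ?thesis using assms(2) by (simp add: supported_def n_def)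
    qed
  qed
  moreover have "0 \<le> frm p n"
    unfolding form_eq_sum_pair[of p n]
  proof (rule sum_nonneg)
    fix w assume "w \<in> V"
    then show "0 \<le> n w * pair p w"
      using pair_nonneg[of w p] by (cases "x w < 0") (simp_all add: n_def p_def mult_nonpos_nonneg)
  qed
  moreover have "frm n n = frm p n - frm x n"
    by (subst (1) form_cong[where x' = "\<lambda>v. p v - x v" and y' = n]) (auto simp: n form_diff_left)
  ultimately have "\<not> frm n n < 0" by simp
  moreover have "supported V n" using assms(1,2) by (auto simp: supported_def n_def)
  ultimately have "n = (\<lambda>_. 0)" using form_neg by blast
  then have "n v = 0" by simp
  then show ?thesis by (simp add: n_def max_def split: if_splits)
qed

text \<open>At \<open>v\<close> the minimum agrees with one of the two cycles and lies below it
  everywhere, so \<open>pair_mono\<close> applies.\<close>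

lemma pair_min_nonpos:
  assumes "v \<in> V" "pair x v \<le> 0" "pair y v \<le> 0"
  shows "pair (\<lambda>u. min (x u) (y u)) v \<le> 0"
proof (cases "x v \<le> y v")
  case True
  then have "pair (\<lambda>u. min (x u) (y u)) v \<le> pair x v" by (intro pair_mono assms(1)) auto
  then show ?thesis using assms(2) by simp
next
  case False
  then have "pair (\<lambda>u. min (x u) (y u)) v \<le> pair y v" by (intro pair_mono assms(1)) auto
  then show ?thesis using assms(3) by simp
qed

section \<open>Minimal cycles\<close>

text \<open>Membership in L' follows from the class condition: \<open>K\<close> has integral
  intersection numbers, and so does the integral difference \<open>x - K\<close>.\<close>

lemma SpK_iff:
  "x \<in> SpK V adj e \<longleftrightarrow> supported V x \<and> (\<forall>v\<in>V. pair x v \<le> 0) \<and> integral (\<lambda>v. x v - K v)"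
proof -
  have "pair x v \<in> \<int>" if "integral (\<lambda>v. x v - K v)" "v \<in> V" for v
  proof -
    have "pair x v = pair (\<lambda>v. x v - K v) v + pair K v" by (simp add: form_diff_left)
    then show ?thesis using pair_integral[OF that(2,1)] pair_ZK[OF that(2)]
      by (simp add: Ints_add)
  qed
  then show ?thesis unfolding SpK_def in_Ldual_iff by auto
qed

lemma SpK_min:
  assumes "x \<in> SpK V adj e" "y \<in> SpK V adj e"
  shows "(\<lambda>v. min (x v) (y v)) \<in> SpK V adj e"
proof -
  have "integral (\<lambda>v. min (x v) (y v) - K v)"
    using assms unfolding SpK_iff integral_def by (auto simp: min_def)
  moreover have "supported V (\<lambda>v. min (x v) (y v))"
    using assms unfolding SpK_iff supported_def by auto
  ultimately show ?thesis using assms pair_min_nonpos unfolding SpK_iff by blast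
qed

lemma lleq_antisym:
  assumes "supported A x" "supported A y" "lleq A x y" "lleq A y x"
  shows "x = y"
proof
  fix v show "x v = y v"
    using assms by (cases "v \<in> A") (auto simp: supported_def lleq_def intro: antisym)
qed

lemma sK_least:
  assumes "SpK V adj e \<noteq> {}"
  shows "sK V adj e \<in> SpK V adj e" "y \<in> SpK V adj e \<Longrightarrow> lleq V (sK V adj e) y"
proof -
  let ?P = "\<lambda>x. x \<in> SpK V adj e \<and> (\<forall>y\<in>SpK V adj e. lleq V x y)"
  have "\<exists>x. ?P x"
  proof -
    have "\<exists>x\<in>SpK V adj e. \<forall>y\<in>SpK V adj e. lleq V x y"
    proof (rule exists_coordinatewise_minimum[OF finite_V assms])
      fix x y v assume "x \<in> SpK V adj e" "y \<in> SpK V adj e"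
      then have "(x v - K v) - (y v - K v) \<in> \<int>"
        unfolding SpK_iff integral_def by (blast intro: Ints_diff)
      then show "x v - y v \<in> \<int>" by simp
    next
      fix x v assume "x \<in> SpK V adj e"
      then show "0 \<le> x v" using antinef_nonneg[of V x v] unfolding SpK_iff by blast
    qed (rule SpK_min)
    then show ?thesis by blast
  qed
  moreover have "x = y" if "?P x" "?P y" for x y
    by (rule lleq_antisym[of V]) (use that in \<open>auto simp: SpK_iff\<close>)
  ultimately have "\<exists>!x. ?P x" by blast
  then have "?P (sK V adj e)" unfolding sK_def by (rule theI')
  then show "sK V adj e \<in> SpK V adj e" "y \<in> SpK V adj e \<Longrightarrow> lleq V (sK V adj e) y" by blast+
qed

text \<open>Connectedness of \<open>B\<close> gives every member of \<open>ZminSet\<close> full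
  support. This keeps the minimum of two members nonzero, so the set is closed under minima and has
  a least element.\<close>

lemma Zmin_least:
  assumes B: "B \<subseteq> V"
    and connected: "\<And>A. \<lbrakk>A \<subseteq> B; A \<noteq> {}; A \<noteq> B\<rbrakk> \<Longrightarrow> \<exists>v\<in>A. \<exists>w\<in>B - A. adj v w"
    and nonempty: "ZminSet V adj e B \<noteq> {}"
  shows "Zmin V adj e B \<in> ZminSet V adj e B"
    and "y \<in> ZminSet V adj e B \<Longrightarrow> lleq B (Zmin V adj e B) y"
proof -
  let ?S = "ZminSet V adj e B"
  let ?P = "\<lambda>x. x \<in> ?S \<and> (\<forall>y\<in>?S. lleq B x y)"
  have nonneg: "0 \<le> x v" if "x \<in> ?S" for x v
    using antinef_nonneg[OF B, of x v] that unfolding ZminSet_def by blast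
  have pos: "0 < x v" if x: "x \<in> ?S" and v: "v \<in> B" for x v
  \<comment> \<open>Otherwise an edge inside \<open>B\<close> leads from the positive part of
    \<open>x\<close> to a vertex \<open>u\<close> with \<open>x u = 0\<close>, where the
    intersection number would be positive.\<close>
  proof (rule ccontr)
    assume "\<not> 0 < x v"
    then have "v \<notin> {v \<in> B. 0 < x v}" by simp
    moreover have "{v \<in> B. 0 < x v} \<noteq> {}"
    proof
      assume "{v \<in> B. 0 < x v} = {}"
      then have "x u = 0" for u
        using x nonneg[OF x, of u] unfolding ZminSet_def supported_def
        by (cases "u \<in> B") force+
      then show False using x by (auto simp: ZminSet_def)
    qed
    ultimately obtain w u where "w \<in> B" "0 < x w" "u \<in> B" "\<not> 0 < x u" "adj w u"
      using connected[of "{v \<in> B. 0 < x v}"] v by blast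
    moreover from this have "x u = 0" using nonneg[OF x, of u] by simp
    ultimately have "0 < pair x u"
      using pair_pos[of u x w] nonneg[OF x] B by fastforce
    then show False using x \<open>u \<in> B\<close> by (auto simp: ZminSet_def)
  qed
  have "\<exists>x. ?P x"
  proof -
    have "\<exists>x\<in>?S. \<forall>y\<in>?S. lleq B x y"
    proof (rule exists_coordinatewise_minimum)
      show "finite B" using B finite_V finite_subset by blast
    next
      fix x y assume x: "x \<in> ?S" and y: "y \<in> ?S"
      let ?m = "\<lambda>v. min (x v) (y v)"
      obtain v where "v \<in> B"
        using x unfolding ZminSet_def supported_def by fastforce
      then have "?m v > 0" using pos x y by simp
      then have "?m \<noteq> (\<lambda>_. 0)" by (metis less_irrefl)
      moreover have "supported B ?m" "integral ?m"
        using x y unfolding ZminSet_def supported_def integral_def by (auto simp: min_def)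
      moreover have "\<forall>v\<in>B. pair ?m v \<le> 0"
        using x y pair_min_nonpos B unfolding ZminSet_def by blast
      ultimately show "?m \<in> ?S" unfolding ZminSet_def by blast
    qed (use nonempty nonneg in \<open>auto simp: ZminSet_def integral_def\<close>)
    then show ?thesis by blast
  qed
  moreover have "x = y" if "?P x" "?P y" for x y
    by (rule lleq_antisym[of B]) (use that in \<open>auto simp: ZminSet_def\<close>)
  ultimately have "\<exists>!x. ?P x" by blast
  then have "?P (Zmin V adj e B)" unfolding Zmin_def by (rule theI')
  then show "Zmin V adj e B \<in> ?S" "y \<in> ?S \<Longrightarrow> lleq B (Zmin V adj e B) y" by blast+
qed

lemma chi_add: "\<chi> (\<lambda>v. x v + y v) = \<chi> x + \<chi> y - frm x y"
proof -
  have chi_eq: "\<chi> z = - (frm z z - frm z K) / 2" for z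
    unfolding chi_def using form_diff_left[of V adj e z K z]
    by (simp add: form_sym[of z "\<lambda>v. z v - K v"] form_sym[of z K])
  let ?s = "\<lambda>v. x v + y v"
  have "frm ?s ?s = frm x ?s + frm y ?s" by (rule form_add_left)
  moreover have "frm x ?s = frm x x + frm x y"
    using form_add_left[of V adj e x y x] form_sym[of x ?s] form_sym[of x y] by linarith
  moreover have "frm y ?s = frm x y + frm y y"
    using form_add_left[of V adj e x y y] form_sym[of y ?s] by linarith
  moreover have "frm ?s K = frm x K + frm y K" by (rule form_add_left)
  ultimately show ?thesis unfolding chi_eq by (simp add: field_simps)
qed

text \<open>Adjunction for a rational curve: -(e_v - (e_v + 2))/2 = 1. This is the cost of adding
  one vertex when supports are enlarged below.\<close>

lemma chi_Ebas: "v \<in> V \<Longrightarrow> \<chi> (Ebas v) = 1"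
  unfolding chi_def form_sym[of "Ebas v"] by (simp add: form_diff_left pair_Ebas_self pair_ZK)

end

section \<open>Elliptic graphs\<close>

locale elliptic_plumbing =
  fixes V :: "'v set" and adj :: "'v \<Rightarrow> 'v \<Rightarrow> bool" and e :: "'v \<Rightarrow> int"
  assumes elliptic: "elliptic_graph V adj e"
begin

sublocale negdef_graph
  using elliptic by unfold_locales (auto simp: elliptic_graph_def is_tree_def)

text \<open>Decorations at most -2 make e_v + 2 nonpositive. Hence the class of \<open>K\<close> has
  anti-nef members, and \<open>sK\<close> exists and lies below \<open>K\<close>.\<close>

lemma ZK_SpK: "K \<in> SpK V adj e"
proof -
  have "pair K v \<le> 0" if "v \<in> V" for v
  proof -
    have "e v \<le> -2" using elliptic that by (auto simp: elliptic_graph_def)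
    then have "of_int (e v) \<le> (of_int (-2) :: rat)" by (rule of_int_le_iff[THEN iffD2])
    then show ?thesis using that by (simp add: pair_ZK)
  qed
  then show ?thesis unfolding SpK_iff by (simp add: ZK_supported integral_def)
qed

lemma chi_nonneg: "\<lbrakk>x \<in> Lat V; \<And>v. 0 \<le> x v\<rbrakk> \<Longrightarrow> 0 \<le> \<chi> x"
  using elliptic unfolding elliptic_graph_def lleq_def
  by (cases "x = (\<lambda>_. 0)") (auto simp: chi_def form_def)

lemma exists_boundary_edge:
  assumes "A \<subseteq> V" "A \<noteq> {}" "A \<noteq> V"
  shows "\<exists>v\<in>A. \<exists>w\<in>V - A. adj v w"
proof (rule ccontr)
  assume neg: "\<not> ?thesis"
  obtain a b where ab: "a \<in> A" "b \<in> V" "b \<notin> A" using assms by blast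
  have "(a, b) \<in> {(a, b). adj a b}\<^sup>*"
    using elliptic ab assms(1) unfolding elliptic_graph_def is_tree_def by blast
  then have "b \<in> A"
  proof (induction rule: rtrancl_induct)
    case (step y z)
    moreover have "z \<in> V" using step elliptic unfolding elliptic_graph_def is_tree_def by blast
    ultimately show ?case using neg by blast
  qed (use ab in simp)
  then show False using ab by simp
qed

section \<open>Supports of effective cycles with vanishing \<chi>\<close>

definition chi_null :: "('v \<Rightarrow> rat) \<Rightarrow> bool" where
  "chi_null x \<longleftrightarrow> x \<in> Lat V \<and> (\<forall>v. 0 \<le> x v) \<and> x \<noteq> (\<lambda>_. 0) \<and> \<chi> x = 0"

lemma chi_null_supports_meet:
  assumes "chi_null x" "chi_null y"
  shows "supp V x \<inter> supp V y \<noteq> {}"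
proof
  assume "supp V x \<inter> supp V y = {}"
  \<comment> \<open>A member of \<open>S\<close> with largest support replaces the repeated
    enlargement: a boundary edge of its support leads to a contradiction, whether it ends in the
    support of \<open>y\<close> or not.\<close>
  define S where "S = {z. chi_null z \<and> supp V z \<inter> supp V y = {}}"
  have "x \<in> S" using assms \<open>supp V x \<inter> supp V y = {}\<close> by (simp add: S_def)
  moreover have "card (supp V z) \<le> card V" for z
    by (rule card_mono[OF finite_V]) (auto simp: supp_def)
  then have "\<forall>z. z \<in> S \<longrightarrow> card (supp V z) < Suc (card V)" by (simp add: less_Suc_eq_le)
  ultimately obtain z where z: "z \<in> S"
    and maximal: "\<And>z'. z' \<in> S \<Longrightarrow> card (supp V z') \<le> card (supp V z)"
    using ex_has_greatest_nat[of "\<lambda>z. z \<in> S" x "\<lambda>z. card (supp V z)" "Suc (card V)"]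
    by auto
  have zL: "z \<in> Lat V" "\<And>v. 0 \<le> z v" "z \<noteq> (\<lambda>_. 0)" "\<chi> z = 0"
    using z by (auto simp: S_def chi_null_def)
  have yL: "y \<in> Lat V" "\<And>v. 0 \<le> y v" "y \<noteq> (\<lambda>_. 0)" "\<chi> y = 0"
    using assms by (auto simp: chi_null_def)
  have supp_ne: "supp V u \<noteq> {}" if "u \<in> Lat V" "u \<noteq> (\<lambda>_. 0)" for u
  proof
    assume "supp V u = {}"
    then have "u v = 0" for v
      using that(1) by (cases "v \<in> V") (auto simp: Lat_def supported_def supp_def)
    then show False using that(2) by blast
  qed
  have "supp V z \<noteq> V"
  proof -
    have "supp V y \<subseteq> V" by (auto simp: supp_def)
    then show ?thesis using z supp_ne[OF yL(1,3)] unfolding S_def by blast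
  qed
  then obtain v w where v: "v \<in> supp V z" and w: "w \<in> V" "w \<notin> supp V z" "adj v w"
    using exists_boundary_edge[of "supp V z"] supp_ne[OF zL(1,3)] unfolding supp_def by blast
  have zw: "z w = 0" using w by (simp add: supp_def)
  have "v \<in> V" "z v > 0" using v zL(2)[of v] by (auto simp: supp_def less_le)
  then have zv: "z v \<le> pair z w"
    using pair_pos[of w z v] w zL(2) zw by blast
  have "pair z w \<in> \<int>" using pair_integral[OF w(1)] zL(1) by (simp add: Lat_def)
  with zv \<open>z v > 0\<close> have ge1: "1 \<le> pair z w"
    by (metis Ints_cases of_int_0_less_iff of_int_1_le_iff less_le_trans int_one_le_iff_zero_less)
  show False
  proof (cases "w \<in> supp V y")
    case True
    have "y w > 0" using True yL(2)[of w] by (auto simp: supp_def less_le)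
    \<comment> \<open>On the support of \<open>y\<close> the cycle \<open>z\<close> vanishes, so all
      terms are nonnegative; the term at \<open>w\<close> is positive. Thus (z,y) > 0, and the cross
      term in \<open>chi_add\<close> makes \<chi> of the sum negative.\<close>
    have "0 < (\<Sum>u\<in>V. y u * pair z u)"
    proof (rule sum_pos2[OF finite_V w(1)])
      show "0 < y w * pair z w" using \<open>y w > 0\<close> ge1 by simp
      fix u assume "u \<in> V"
      show "0 \<le> y u * pair z u"
      proof (cases "y u = 0")
        case False
        then have "z u = 0" using z \<open>u \<in> V\<close> by (auto simp: S_def supp_def)
        then show ?thesis using pair_nonneg[OF \<open>u \<in> V\<close>] zL(2) yL(2)[of u] by simp
      qed simp
    qed
    then have "\<chi> (\<lambda>v. z v + y v) < 0"
      unfolding chi_add form_eq_sum_pair[of z y] using zL(4) yL(4) by simp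
    moreover have "(\<lambda>v. z v + y v) \<in> Lat V"
      using zL(1) yL(1) by (auto simp: Lat_def supported_def integral_def)
    moreover have "0 \<le> z u + y u" for u using zL(2)[of u] yL(2)[of u] by simp
    ultimately show False using chi_nonneg[of "\<lambda>v. z v + y v"] by fastforce
  next
    case False
    \<comment> \<open>Adding E_w costs \<chi>(E_w) = 1 and gains (z,E_w), which is at least 1, so
      \<chi> stays at most 0 and hence equals 0.\<close>
    define u where "u = (\<lambda>v. z v + Ebas w v)"
    have uL: "u \<in> Lat V" using zL(1) w(1)
      by (auto simp: u_def Lat_def supported_def integral_def Ebas_def)
    have u_nonneg: "0 \<le> u v" for v using zL(2)[of v] by (simp add: u_def Ebas_def)
    have "\<chi> u \<le> 0" unfolding u_def chi_add using zL(4) chi_Ebas[OF w(1)] ge1 by simp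
    then have "\<chi> u = 0" using chi_nonneg[OF uL u_nonneg] by simp
    moreover have "u w \<noteq> 0" using zw by (simp add: u_def Ebas_def)
    ultimately have "chi_null u" using uL u_nonneg by (auto simp: chi_null_def)
    moreover have supp_u: "supp V u = insert w (supp V z)"
      using zw w(1) by (auto simp: supp_def u_def Ebas_def)
    moreover have "insert w (supp V z) \<inter> supp V y = {}" using False z by (auto simp: S_def)
    ultimately have "u \<in> S" by (simp add: S_def)
    moreover have "card (supp V u) = Suc (card (supp V z))"
      unfolding supp_u using w(2) finite_V by (simp add: supp_def)
    ultimately show False using maximal by fastforce
  qed
qed

text \<open>Without an edge between \<open>A\<close> and the rest, \<open>x\<close> splits into two
  orthogonal effective parts. Their \<chi> values are nonnegative with sum 0, so both are
  \<open>chi_null\<close> with disjoint supports.\<close>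

lemma chi_null_connected:
  assumes x: "chi_null x" and A: "A \<subseteq> supp V x" "A \<noteq> {}" "A \<noteq> supp V x"
  shows "\<exists>v\<in>A. \<exists>w\<in>supp V x - A. adj v w"
proof (rule ccontr)
  assume neg: "\<not> ?thesis"
  define y where "y = (\<lambda>v. if v \<in> A then x v else 0)"
  define z where "z = (\<lambda>v. if v \<in> A then 0 else x v)"
  have xL: "x \<in> Lat V" "\<And>v. 0 \<le> x v" "\<chi> x = 0" using x by (auto simp: chi_null_def)
  have yL: "y \<in> Lat V" "\<And>v. 0 \<le> y v" and zL: "z \<in> Lat V" "\<And>v. 0 \<le> z v"
    using xL by (auto simp: y_def z_def Lat_def supported_def integral_def)
  have "intmat adj e v w * y v * z w = 0" if "v \<in> V" "w \<in> V" for v w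
  proof (cases "v \<in> A \<and> w \<in> supp V x - A")
    case True
    then show ?thesis using neg by (auto simp: intmat_def)
  next
    case False
    then show ?thesis using that by (auto simp: y_def z_def supp_def)
  qed
  then have "frm y z = 0" unfolding form_def by (intro sum.neutral ballI)
  moreover have "x = (\<lambda>v. y v + z v)" by (auto simp: y_def z_def)
  ultimately have "\<chi> y + \<chi> z = 0" using chi_add[of y z] xL(3) by simp
  then have "\<chi> y = 0" "\<chi> z = 0" using chi_nonneg[OF yL] chi_nonneg[OF zL] by auto
  moreover obtain v where "v \<in> A" "x v \<noteq> 0" using A by (auto simp: supp_def)
  then have "y v \<noteq> 0" by (simp add: y_def)
  then have "y \<noteq> (\<lambda>_. 0)" by auto
  moreover obtain w where "w \<notin> A" "x w \<noteq> 0" using A by (auto simp: supp_def)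
  then have "z w \<noteq> 0" by (simp add: z_def)
  then have "z \<noteq> (\<lambda>_. 0)" by auto
  ultimately have "chi_null y" "chi_null z" using yL zL by (auto simp: chi_null_def)
  from chi_null_supports_meet[OF this] show False by (auto simp: supp_def y_def z_def split: if_splits)
qed

text \<open>Since D - K = -c, \<chi>(D) is half the sum of the nonpositive terms
  \<open>D v * pair c v\<close>. Nonnegativity of \<chi> makes every single term vanish.\<close>

lemma SpK_below_ZK:
  assumes c: "c \<in> SpK V adj e" and le: "lleq V c K"
  defines "D \<equiv> \<lambda>v. K v - c v"
  shows "D \<in> Lat V" and "0 \<le> D v" and "\<chi> D = 0"
    and "\<lbrakk>v \<in> V; D v \<noteq> 0\<rbrakk> \<Longrightarrow> pair c v = 0"
proof -
  have "K v - c v \<in> \<int>" for v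
    using c Ints_minus[of "c v - K v"] by (simp add: SpK_iff integral_def)
  then show DL: "D \<in> Lat V"
    using c ZK_supported by (auto simp: D_def Lat_def SpK_iff supported_def integral_def)
  show D0: "0 \<le> D v" for v
    using le c ZK_supported by (cases "v \<in> V") (auto simp: D_def lleq_def SpK_iff supported_def)
  have term_le: "D v * pair c v \<le> 0" if "v \<in> V" for v
    using c D0[of v] that by (simp add: SpK_iff mult_nonneg_nonpos)
  have "(\<lambda>v. D v - K v) = (\<lambda>v. (-1) * c v + 0 * c v)" by (auto simp: D_def)
  then have "frm D (\<lambda>v. D v - K v) = - frm c D"
    unfolding form_sym[of D] using form_linear_left[of V adj e "-1" c 0 c D] by simp
  then have chi_D: "\<chi> D = (\<Sum>v\<in>V. D v * pair c v) / 2"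
    unfolding chi_def form_eq_sum_pair[of c D] by simp
  moreover have "(\<Sum>v\<in>V. D v * pair c v) \<le> 0" using term_le by (rule sum_nonpos)
  ultimately show X0: "\<chi> D = 0" using chi_nonneg[OF DL D0] by simp
  then have "(\<Sum>v\<in>V. - (D v * pair c v)) = 0" using chi_D by (simp add: sum_negf)
  then show "pair c v = 0" if "v \<in> V" "D v \<noteq> 0"
    using that sum_nonneg_eq_0_iff[OF finite_V, of "\<lambda>v. - (D v * pair c v)"] term_le by auto
qed

text \<open>The difference d - c belongs to \<open>ZminSet\<close>: off \<open>B\<close> both cycles
  equal \<open>K\<close>, and on \<open>B\<close> the cycle c is orthogonal, leaving the
  intersection numbers of d. The choice d = K shows that \<open>ZminSet\<close> is nonempty.\<close>

lemma Zmin_supp_least: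
  assumes c: "c \<in> SpK V adj e" and le: "lleq V c K" and ne: "c \<noteq> K"
  defines "B \<equiv> supp V (\<lambda>v. K v - c v)"
  shows "Zmin V adj e B \<in> ZminSet V adj e B"
    and "\<lbrakk>d \<in> SpK V adj e; lleq V c d; lleq V d K; d \<noteq> c\<rbrakk>
      \<Longrightarrow> c v + Zmin V adj e B v \<le> d v"
proof -
  let ?D = "\<lambda>v. K v - c v"
  note D = SpK_below_ZK[OF c le]
  have "?D \<noteq> (\<lambda>_. 0)" using ne by (metis eq_iff_diff_eq_0 ext)
  then have null: "chi_null ?D" using D by (simp add: chi_null_def)
  have mem: "(\<lambda>v. d v - c v) \<in> ZminSet V adj e B"
    if d: "d \<in> SpK V adj e" and cd: "lleq V c d" and dK: "lleq V d K" and "d \<noteq> c" for d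
  proof -
    have "d v - c v = 0" if "v \<notin> B" for v
      using c d cd dK that
      by (cases "v \<in> V") (force simp: B_def supp_def SpK_iff supported_def lleq_def)+
    then have "supported B (\<lambda>v. d v - c v)" by (simp add: supported_def)
    moreover have "(d v - K v) - (c v - K v) \<in> \<int>" for v
      using c d unfolding SpK_iff integral_def by (blast intro: Ints_diff)
    then have "integral (\<lambda>v. d v - c v)" by (simp add: integral_def)
    moreover have "pair (\<lambda>v. d v - c v) v \<le> 0" if "v \<in> B" for v
      using that D(4)[of v] d by (auto simp: B_def supp_def form_diff_left SpK_iff)
    moreover have "(\<lambda>v. d v - c v) \<noteq> (\<lambda>_. 0)" using \<open>d \<noteq> c\<close> by (auto simp: fun_eq_iff)
    ultimately show ?thesis by (simp add: ZminSet_def)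
  qed
  have "lleq V K K" by (simp add: lleq_def)
  then have "ZminSet V adj e B \<noteq> {}" using mem[OF ZK_SpK le] ne by blast
  moreover have "B \<subseteq> V" by (auto simp: B_def supp_def)
  ultimately have least: "Zmin V adj e B \<in> ZminSet V adj e B"
    "\<And>y. y \<in> ZminSet V adj e B \<Longrightarrow> lleq B (Zmin V adj e B) y"
    using Zmin_least[of B] chi_null_connected[OF null] unfolding B_def by blast+
  show Z: "Zmin V adj e B \<in> ZminSet V adj e B" by (rule least)
  show "c v + Zmin V adj e B v \<le> d v"
    if d: "d \<in> SpK V adj e" "lleq V c d" "lleq V d K" "d \<noteq> c"
  proof (cases "v \<in> B")
    case True
    then have "Zmin V adj e B v \<le> d v - c v" using least(2)[OF mem[OF d]] by (simp add: lleq_def)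
    then show ?thesis by simp
  next
    case False
    have "c v \<le> d v"
      using d(1,2) c by (cases "v \<in> V") (auto simp: SpK_iff supported_def lleq_def)
    then show ?thesis using False Z by (simp add: ZminSet_def supported_def)
  qed
qed

section \<open>The NN-elliptic sequence\<close>

lemma NN_C_SpK:
  assumes "\<forall>i<k. NN_C V adj e i \<noteq> K"
  shows "NN_C V adj e k \<in> SpK V adj e \<and> lleq V (NN_C V adj e k) K"
  using assms
proof (induction k)
  case 0
  then show ?case using sK_least ZK_SpK by auto
next
  case (Suc k)
  let ?c = "NN_C V adj e k"
  define B where "B = supp V (\<lambda>v. K v - ?c v)"
  define Z where "Z = Zmin V adj e B"
  have c: "?c \<in> SpK V adj e" "lleq V ?c K" and ne: "?c \<noteq> K" using Suc by auto
  have Z: "Z \<in> ZminSet V adj e B"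
    unfolding Z_def B_def using Zmin_supp_least(1)[OF c ne] .
  have "lleq V K K" by (simp add: lleq_def)
  then have le: "?c v + Z v \<le> K v" for v
    unfolding Z_def B_def using Zmin_supp_least(2)[OF c ne ZK_SpK c(2)] ne by metis
  have "pair (\<lambda>v. ?c v + Z v) v \<le> 0" if v: "v \<in> V" for v
  proof (cases "v \<in> B")
    case True
    then have "pair ?c v = 0" using SpK_below_ZK(4)[OF c v] by (simp add: B_def supp_def)
    then show ?thesis using Z True by (simp add: form_add_left ZminSet_def)
  \<comment> \<open>Off \<open>B\<close> the new cycle still agrees with \<open>K\<close> and lies
    below \<open>K\<close> everywhere, so its intersection number is bounded by that of
    \<open>K\<close>.\<close>
  next
    case False
    then have "?c v = K v" "Z v = 0" using v Z by (auto simp: B_def supp_def ZminSet_def supported_def)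
    then have "pair (\<lambda>v. ?c v + Z v) v \<le> pair K v" using le v by (intro pair_mono) auto
    then show ?thesis using ZK_SpK v by (auto simp: SpK_iff)
  qed
  moreover have "integral (\<lambda>v. ?c v + Z v - K v)"
    unfolding integral_def
  proof
    fix v
    have "(?c v - K v) + Z v \<in> \<int>"
      using c(1) Z unfolding SpK_iff ZminSet_def integral_def by (blast intro: Ints_add)
    then show "?c v + Z v - K v \<in> \<int>" by (simp add: algebra_simps)
  qed
  moreover have "supported V (\<lambda>v. ?c v + Z v)"
    using c(1) Z unfolding SpK_iff ZminSet_def supported_def B_def supp_def by auto
  ultimately have "(\<lambda>v. ?c v + Z v) \<in> SpK V adj e" unfolding SpK_iff by blast
  then show ?case using le by (simp add: Z_def B_def lleq_def)
qed

text \<open>If the sequence never hit \<open>d\<close>, each step would stay below \<open>d\<close>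
  by minimality of \<open>Zmin\<close>, starting from the minimum \<open>sK\<close>. At index
  \<open>M\<close> this gives K \<le> d, hence d = K.\<close>

lemma SpK_below_ZK_in_NN_C:
  assumes d: "d \<in> SpK V adj e" "lleq V d K" "d \<noteq> K"
    and M: "NN_C V adj e M = K" "\<forall>k<M. NN_C V adj e k \<noteq> K"
  shows "\<exists>k<M. NN_C V adj e k = d"
proof (rule ccontr)
  assume neg: "\<not> ?thesis"
  have "lleq V (NN_C V adj e k) d" if "k \<le> M" for k
    using that
  proof (induction k)
    case 0
    then show ?case using sK_least(2)[OF _ d(1)] d(1) by auto
  next
    case (Suc k)
    then have IH: "lleq V (NN_C V adj e k) d" and k: "k < M" by simp_all
    have c: "NN_C V adj e k \<in> SpK V adj e" "lleq V (NN_C V adj e k) K" "NN_C V adj e k \<noteq> K"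
      using NN_C_SpK[of k] M(2) k by auto
    have "d \<noteq> NN_C V adj e k" using neg k by blast
    from Zmin_supp_least(2)[OF c d(1) IH d(2) this] show ?case by (simp add: lleq_def)
  qed
  then have "lleq V K d" using M(1) by (metis order_refl)
  then show False
    using lleq_antisym[of V d K] d ZK_supported by (auto simp: SpK_iff)
qed

section \<open>The support of the canonical polynomial\<close>

text \<open>A nonzero sum has an index \<open>k\<close>, so \<open>x\<close> is the combination of
  the E_v^* with coefficients \<open>k v\<close>, and (x,E_w) = -k_w.\<close>

lemma zcoef_nonzero_antinef:
  assumes "zcoef V adj e x \<noteq> 0"
  shows "\<forall>v\<in>V. pair x v \<le> 0"
proof -
  obtain k :: "'v \<Rightarrow> nat"
    where "\<forall>w. (\<Sum>v\<in>V. of_nat (k v) * Estar V adj e v w) = x w"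
    using assms unfolding zcoef_def
    by (rule sum.not_neutral_contains_not_neutral) blast
  then have "x = (\<lambda>w. \<Sum>v\<in>V. of_nat (k v) * Estar V adj e v w)" by auto
  then have "pair x w = (\<Sum>v\<in>V. of_nat (k v) * pair (Estar V adj e v) w)" for w
    by (simp only: form_sum_left)
  then show ?thesis by (auto simp: pair_Estar intro!: sum_nonpos)
qed

lemma SuppP0_assoc:
  assumes l: "l \<in> SuppP0 V adj e"
  obtains lp where "lp \<in> SpK V adj e" "lleq V lp K" "lp \<noteq> K" "is_assoc V adj e l lp"
proof -
  define x where "x = (\<lambda>w. K w - Etot V w - l w)"
  define lp where "lp = (\<lambda>v. min (x v) (K v))"
  have L: "supported V l" "integral l" and "\<not> (\<forall>v\<in>V. l v < 0)" and "zcoef V adj e x \<noteq> 0"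
    using l by (auto simp: SuppP0_def Lat_def x_def)
  have "x v - K v \<in> \<int>" for v
  proof -
    have "x v - K v = - (Etot V v + l v)" by (simp add: x_def)
    moreover have "Etot V v + l v \<in> \<int>" using L(2) by (auto simp: Etot_def integral_def)
    ultimately show ?thesis by (metis Ints_minus)
  qed
  moreover have "supported V x"
    using L(1) ZK_supported by (simp add: x_def supported_def Etot_def)
  ultimately have "x \<in> SpK V adj e"
    using zcoef_nonzero_antinef[OF \<open>zcoef V adj e x \<noteq> 0\<close>] by (simp add: SpK_iff integral_def)
  then have lp: "lp \<in> SpK V adj e" unfolding lp_def using ZK_SpK by (rule SpK_min)
  \<comment> \<open>Integrality absorbs the shift by E: where \<open>l\<close> is negative, K - 1 -
    l is at least K, so the minimum \<open>lp\<close> takes the value of \<open>K\<close>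
    there.\<close>
  have neg: "l v \<le> -1" if "l v < 0" for v
  proof -
    obtain i where "l v = of_int i" using L(2) unfolding integral_def by (blast elim: Ints_cases)
    moreover from this that have "i \<le> -1" by simp
    then have "of_int i \<le> (of_int (-1) :: rat)" by (rule of_int_le_iff[THEN iffD2])
    ultimately show ?thesis by simp
  qed
  have lp_neg: "lp v = K v" if "v \<in> Vneg V l" for v
    using that neg[of v] by (simp add: Vneg_def lp_def x_def Etot_def)
  have lp_nonneg: "lp v = K v - 1 - l v" if "v \<in> V - Vneg V l" for v
    using that by (auto simp: Vneg_def lp_def x_def Etot_def)
  have le: "lleq V lp K" by (simp add: lp_def lleq_def)
  obtain u where "u \<in> V" "0 \<le> l u" using \<open>\<not> (\<forall>v\<in>V. l v < 0)\<close> by (auto simp: not_less)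
  then have "lp u \<noteq> K u" using lp_nonneg[of u] by (simp add: Vneg_def)
  then have "lp \<noteq> K" by auto
  moreover have "is_assoc V adj e l lp"
  proof -
    \<comment> \<open>The excess of \<open>x\<close> over \<open>K\<close> on the negative vertices.
      The value 0 elsewhere serves the sign and integrality conditions, which
      \<open>is_assoc\<close> imposes at every vertex.\<close>
    define m where "m = (\<lambda>v. if v \<in> Vneg V l then - 1 - l v else 0)"
    have "m v \<in> \<int> \<and> 0 \<le> m v" for v
      using L(2) neg[of v] by (simp add: m_def integral_def Vneg_def)
    moreover have "l v = K v - 1 - lp v - (if v \<in> Vneg V l then m v else 0)" if "v \<in> V" for v
      using lp_neg[of v] lp_nonneg[of v] that by (auto simp: m_def)
    ultimately show ?thesis
      using lp le lp_neg unfolding is_assoc_def SpK_def by blast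
  qed
  ultimately show thesis using that lp le by blast
qed

text \<open>Outside \<open>Vneg V l\<close> the difference K - lp equals l + 1, which is positive;
  on \<open>Vneg V l\<close> it is 0.\<close>

lemma is_assoc_Vneg:
  assumes "is_assoc V adj e l lp"
  shows "Vneg V l = V - supp V (\<lambda>v. K v - lp v)"
proof -
  have "v \<in> Vneg V l \<longleftrightarrow> K v = lp v" if "v \<in> V" for v
    using assms that unfolding is_assoc_def by (cases "v \<in> Vneg V l") (auto simp: Vneg_def)
  then show ?thesis by (auto simp: supp_def Vneg_def)
qed

end

text \<open>The index \<open>k\<close> stands for j + 1 and \<open>M\<close> for m + 1, so
  \<open>k < M\<close> covers C_{-1}, ..., C_{m-1}. The conditions in \<open>is_assoc\<close>
  determine the associated cycle, so the existential form of (1) says that this cycle occurs in the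
  list.\<close>

theorem mainTheorem1:
  fixes V :: "'v set" and adj :: "'v \<Rightarrow> 'v \<Rightarrow> bool" and e :: "'v \<Rightarrow> int" and M :: nat
  assumes "elliptic_graph V adj e"
    and "NN_C V adj e M = ZK V adj e"
    and "\<forall>k<M. NN_C V adj e k \<noteq> ZK V adj e"
  shows "(\<forall>l \<in> SuppP0 V adj e. \<exists>k<M. is_assoc V adj e l (NN_C V adj e k)) \<and>
         (\<forall>k<M. \<forall>l \<in> SuppP0 V adj e. is_assoc V adj e l (NN_C V adj e k) \<longrightarrow>
            Vneg V l = V - NN_B V adj e (Suc k))"
proof -
  interpret elliptic_plumbing V adj e by unfold_locales (rule assms(1))
  have "\<exists>k<M. is_assoc V adj e l (NN_C V adj e k)" if l: "l \<in> SuppP0 V adj e" for l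
  proof -
    obtain lp where "lp \<in> SpK V adj e" "lleq V lp (ZK V adj e)" "lp \<noteq> ZK V adj e"
      and assoc: "is_assoc V adj e l lp"
      using SuppP0_assoc[OF l] .
    then have "\<exists>k<M. NN_C V adj e k = lp" by (intro SpK_below_ZK_in_NN_C assms(2,3))
    then show ?thesis using assoc by blast
  qed
  \<comment> \<open>\<open>NN_B\<close> at \<open>Suc k\<close> unfolds to the support of K -
    C_{k-1}, so (2) is \<open>is_assoc_Vneg\<close> for that cycle.\<close>
  then show ?thesis using is_assoc_Vneg by simp
qed

end
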